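(* Let $\Omega$ be a nonempty open and convex subset of $\mathbb{R}^n$ and let $F\in\mathcal{F}^1(\Omega)$. Then $$\Gamma^1(F;\Omega)\le 2\,\mathrm{Lip}(Df;\Omega).$$
   Context: Fix an integer $n\ge 1$; $\mathbb{R}^n$ carries the standard scalar product and Euclidean norm. A 1-field on a nonempty set $\Omega\subset\mathbb{R}^n$ is a map $F$ assigning to each $x\in \Omega$ the polynomial $F(x)(a)=f_x+\langle D_xf,a-x\rangle$ ($a\in\mathbb{R}^n$), where $f_x\in\mathbb{R}$ and $D_xf\in\mathbb{R}^n$. For $x\ne y$ in $\Omega$, $$\Gamma^1(F;x,y)=2\sup_{a\in\mathbb{R}^n}\frac{|F(x)(a)-F(y)(a)|}{\|x-a\|^2+\|y-a\|^2},$$ and $\Gamma^1(F;\Omega)=\sup_{x\ne y\in \Omega}\Gamma^1(F;x,y)$. $\mathcal{F}^1(\Omega)$ is the set of 1-fields on $\Omega$ with $\Gamma^1(F;\Omega)<+\infty$. $\mathrm{Lip}(Df;\Omega)=\sup_{x\neq y\in \Omega}\|D_xf-D_yf\|/\|x-y\|$. *)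

theory Defs
  imports "HOL-Analysis.Analysis"
begin

text \<open>
  A field assigns to each point \<open>x\<close> a function \<open>F x\<close> of the variable \<open>a\<close>; only its values for
  \<open>x \<in> \<Omega>\<close> matter. The pair \<open>(f x, D x)\<close> is uniquely determined by \<open>F x\<close>, namely the value and
  the gradient of \<open>F x\<close> at \<open>x\<close>.
\<close>

definition one_field_on ::
  "(real^'n) set \<Rightarrow> (real^'n \<Rightarrow> real^'n \<Rightarrow> real) \<Rightarrow> (real^'n \<Rightarrow> real) \<Rightarrow> (real^'n \<Rightarrow> real^'n) \<Rightarrow> bool" where
  "one_field_on \<Omega> F f D \<longleftrightarrow> (\<forall>x\<in>\<Omega>. \<forall>a. F x a = f x + D x \<bullet> (a - x))"

text \<open>
  The suprema below are of nonnegative quantities and may be infinite, so they are taken in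
  \<^typ>\<open>ennreal\<close>, where the supremum over the empty set (when \<open>\<Omega>\<close> is a single point) is \<open>0\<close>.
\<close>

definition Gamma1 :: "(real^'n \<Rightarrow> real^'n \<Rightarrow> real) \<Rightarrow> real^'n \<Rightarrow> real^'n \<Rightarrow> ennreal" where
  "Gamma1 F x y =
     2 * (SUP a. ennreal (\<bar>F x a - F y a\<bar> / ((norm (x - a))\<^sup>2 + (norm (y - a))\<^sup>2)))"

definition Gamma1_on :: "(real^'n \<Rightarrow> real^'n \<Rightarrow> real) \<Rightarrow> (real^'n) set \<Rightarrow> ennreal" where
  "Gamma1_on F \<Omega> = (SUP (x, y) \<in> {(x, y). x \<in> \<Omega> \<and> y \<in> \<Omega> \<and> x \<noteq> y}. Gamma1 F x y)"

definition F1 :: "(real^'n) set \<Rightarrow> (real^'n \<Rightarrow> real^'n \<Rightarrow> real) set" where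
  "F1 \<Omega> = {F. (\<exists>f D. one_field_on \<Omega> F f D) \<and> Gamma1_on F \<Omega> < \<infinity>}"

definition Lip_on :: "(real^'n \<Rightarrow> real^'n) \<Rightarrow> (real^'n) set \<Rightarrow> ennreal" where
  "Lip_on D \<Omega> =
     (SUP (x, y) \<in> {(x, y). x \<in> \<Omega> \<and> y \<in> \<Omega> \<and> x \<noteq> y}. ennreal (norm (D x - D y) / norm (x - y)))"

end

theory Submission imports Defs
begin

text \<open>
  Finiteness of \<open>\<Gamma>\<^sup>1(F; \<Omega>)\<close>, read at \<open>a = x\<close>, bounds \<open>f x - F y x\<close> by a multiple of
  \<open>\<parallel>x - y\<parallel>\<^sup>2\<close>. Hence on the open set \<open>\<Omega>\<close> the vector \<open>D y\<close> is the actual gradient of \<open>f\<close> at \<open>y\<close>.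
  If \<open>L = Lip(Df; \<Omega>)\<close> is finite, then integrating along segments (convexity) replaces the unknown
  constant by the sharp one: \<open>\<bar>f x - F y x\<bar> \<le> L / 2 \<parallel>x - y\<parallel>\<^sup>2\<close>.

  It remains to compare \<open>F x\<close> and \<open>F y\<close> at an arbitrary point \<open>a\<close>, which need not lie in \<open>\<Omega>\<close>.
  Expanding around \<open>x\<close> or around \<open>y\<close> loses too much. The midpoint \<open>m\<close> of \<open>x\<close> and \<open>y\<close> does
  belong to \<open>\<Omega>\<close>, and both \<open>F x m\<close> and \<open>F y m\<close> are within \<open>L d\<^sup>2 / 8\<close> of \<open>f m\<close>, where
  \<open>d = \<parallel>x - y\<parallel>\<close>. As \<open>F x - F y\<close> is affine with slope \<open>D x - D y\<close> of norm at most \<open>L d\<close>, moving from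
  \<open>m\<close> to \<open>a\<close> gives, with \<open>r = \<parallel>a - m\<parallel>\<close>,
  \<open>\<bar>F x a - F y a\<bar> \<le> L (d\<^sup>2 / 4 + d r)\<close>.
  By the parallelogram law \<open>\<parallel>x - a\<parallel>\<^sup>2 + \<parallel>y - a\<parallel>\<^sup>2 = d\<^sup>2 / 2 + 2 r\<^sup>2\<close>, and this dominates
  \<open>d\<^sup>2 / 4 + d r\<close> because the difference is \<open>(d / 2 - r)\<^sup>2 + r\<^sup>2\<close>. Doubling the resulting bound \<open>L\<close>
  on the quotient gives the factor 2 of the theorem.
\<close>

text \<open>The remainder, divided by \<open>\<parallel>x - y\<parallel>\<close>, is at most \<open>C \<parallel>x - y\<parallel>\<close> and so tends to 0.\<close>

lemma has_derivative_if_quadratic_remainder: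
  fixes f :: "'a::real_inner \<Rightarrow> real"
  assumes "open S" "y \<in> S"
    and rem: "\<And>x. x \<in> S \<Longrightarrow> \<bar>f x - f y - g \<bullet> (x - y)\<bar> \<le> C * (norm (x - y))\<^sup>2"
  shows "(f has_derivative (\<lambda>h. g \<bullet> h)) (at y)"
proof -
  have "(f has_derivative (\<lambda>h. g \<bullet> h)) (at y within S)"
  proof (rule has_derivativeI_sandwich[where e = 1 and H = "\<lambda>x. C * norm (x - y)"])
    show "bounded_linear (\<lambda>h. g \<bullet> h)"
      by (rule bounded_linear_inner_right)
    show "norm (f x - f y - g \<bullet> (x - y)) / norm (x - y) \<le> C * norm (x - y)"
      if "x \<in> S" "x \<noteq> y" for x
      using rem[OF that(1)] that(2) by (simp add: divide_simps power2_eq_square mult.assoc)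
    have "((\<lambda>x. C * norm (x - y)) \<longlongrightarrow> C * norm (y - y)) (at y within S)"
      by (intro tendsto_intros)
    then show "((\<lambda>x. C * norm (x - y)) \<longlongrightarrow> 0) (at y within S)"
      by simp
  qed simp
  then show ?thesis
    by (simp only: at_within_open[OF assms(2,1)])
qed

text \<open>
  Along the segment from \<open>y\<close> to \<open>x\<close>, the derivative at time \<open>t\<close> exceeds its initial value by at
  most \<open>t L \<parallel>x - y\<parallel>\<^sup>2\<close>, whose integral is \<open>L / 2 \<parallel>x - y\<parallel>\<^sup>2\<close>. The integration is carried out by
  observing that the difference to the claimed bound is antitone in \<open>t\<close>.
\<close>

lemma first_order_upper_bound_if_lipschitz_gradient:
  fixes f :: "'a::real_inner \<Rightarrow> real"
  assumes "convex S" "x \<in> S" "y \<in> S"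
    and deriv: "\<And>z. z \<in> S \<Longrightarrow> (f has_derivative (\<lambda>h. D z \<bullet> h)) (at z)"
    and lip: "\<And>u v. u \<in> S \<Longrightarrow> v \<in> S \<Longrightarrow> norm (D u - D v) \<le> L * norm (u - v)"
  shows "f x - f y - D y \<bullet> (x - y) \<le> L / 2 * (norm (x - y))\<^sup>2"
proof -
  define p where "p = (\<lambda>t. y + t *\<^sub>R (x - y))"
  define \<psi> where
    "\<psi> = (\<lambda>t. f (p t) - (t * (D y \<bullet> (x - y)) + L / 2 * t\<^sup>2 * (norm (x - y))\<^sup>2))"
  have "\<psi> 1 \<le> \<psi> 0"
  proof (rule DERIV_nonpos_imp_nonincreasing[where f = \<psi>])
    fix t :: real
    assume t: "0 \<le> t" "t \<le> 1"
    have "p t = (1 - t) *\<^sub>R y + t *\<^sub>R x"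
      by (simp add: p_def algebra_simps)
    then have pt: "p t \<in> S"
      using convexD_alt[OF assms(1,3,2) t] by simp
    have p_deriv: "(p has_derivative (\<lambda>s. s *\<^sub>R (x - y))) (at t)"
      unfolding p_def by (rule derivative_eq_intros refl | simp)+
    have "((\<lambda>s. f (p s)) has_derivative (\<lambda>s. D (p t) \<bullet> (s *\<^sub>R (x - y)))) (at t)"
      by (rule has_derivative_compose[where f = p, OF p_deriv deriv[OF pt]])
    then have "((\<lambda>s. f (p s)) has_real_derivative D (p t) \<bullet> (x - y)) (at t)"
      by (rule has_derivative_imp_has_field_derivative) simp
    moreover have "((\<lambda>s. s * (D y \<bullet> (x - y)) + L / 2 * s\<^sup>2 * (norm (x - y))\<^sup>2)
        has_real_derivative D y \<bullet> (x - y) + L * t * (norm (x - y))\<^sup>2) (at t)"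
      by (auto intro!: derivative_eq_intros)
    ultimately have "(\<psi> has_real_derivative
        D (p t) \<bullet> (x - y) - (D y \<bullet> (x - y) + L * t * (norm (x - y))\<^sup>2)) (at t)"
      unfolding \<psi>_def by (rule DERIV_diff)
    moreover have "D (p t) \<bullet> (x - y) - D y \<bullet> (x - y) \<le> L * t * (norm (x - y))\<^sup>2"
    proof -
      have "D (p t) \<bullet> (x - y) - D y \<bullet> (x - y) \<le> norm (D (p t) - D y) * norm (x - y)"
        using norm_cauchy_schwarz[of "D (p t) - D y" "x - y"] by (simp add: inner_diff_left)
      also have "\<dots> \<le> (L * norm (p t - y)) * norm (x - y)"
        using lip[OF pt assms(3)] by (rule mult_right_mono) simp
      also have "\<dots> = L * t * (norm (x - y))\<^sup>2"
        using t by (simp add: p_def power2_eq_square)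
      finally show ?thesis .
    qed
    ultimately show "\<exists>d. (\<psi> has_real_derivative d) (at t) \<and> d \<le> 0"
      by (intro exI conjI) (assumption, linarith)
  qed simp
  then show ?thesis
    by (simp add: \<psi>_def p_def)
qed

text \<open>The lower bound is the upper bound for \<open>- f\<close>.\<close>

lemma first_order_remainder_if_lipschitz_gradient:
  fixes f :: "'a::real_inner \<Rightarrow> real"
  assumes "convex S" "x \<in> S" "y \<in> S"
    and deriv: "\<And>z. z \<in> S \<Longrightarrow> (f has_derivative (\<lambda>h. D z \<bullet> h)) (at z)"
    and lip: "\<And>u v. u \<in> S \<Longrightarrow> v \<in> S \<Longrightarrow> norm (D u - D v) \<le> L * norm (u - v)"
  shows "\<bar>f x - f y - D y \<bullet> (x - y)\<bar> \<le> L / 2 * (norm (x - y))\<^sup>2"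
proof -
  have "- f x - - f y - (- D y) \<bullet> (x - y) \<le> L / 2 * (norm (x - y))\<^sup>2"
  proof (rule first_order_upper_bound_if_lipschitz_gradient[OF assms(1-3)])
    show "((\<lambda>z. - f z) has_derivative (\<lambda>h. (- D z) \<bullet> h)) (at z)" if "z \<in> S" for z
      using has_derivative_minus[OF deriv[OF that]] by simp
    show "norm (- D u - - D v) \<le> L * norm (u - v)" if "u \<in> S" "v \<in> S" for u v
      using lip[OF that] by (simp add: norm_minus_commute)
  qed
  with first_order_upper_bound_if_lipschitz_gradient[OF assms] show ?thesis
    unfolding inner_minus_left by linarith
qed

text \<open>
  The two expansions meet at the midpoint of \<open>x\<close> and \<open>y\<close>, where both approximate the same value of
  \<open>f\<close>. From there to \<open>a\<close> their difference is affine, so \<open>a\<close> may lie outside \<open>S\<close>.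
\<close>

lemma first_order_expansions_diff_le:
  fixes f :: "'a::real_inner \<Rightarrow> real"
  assumes "convex S" "x \<in> S" "y \<in> S" and L: "0 \<le> L"
    and rem: "\<And>u v. u \<in> S \<Longrightarrow> v \<in> S \<Longrightarrow> \<bar>f u - f v - D v \<bullet> (u - v)\<bar> \<le> L / 2 * (norm (u - v))\<^sup>2"
    and lip: "norm (D x - D y) \<le> L * norm (x - y)"
  shows "\<bar>(f x + D x \<bullet> (a - x)) - (f y + D y \<bullet> (a - y))\<bar>
    \<le> L * ((norm (x - a))\<^sup>2 + (norm (y - a))\<^sup>2)"
proof -
  define m where "m = midpoint x y"
  define d where "d = norm (x - y)"
  define r where "r = norm (a - m)"
  have m: "m \<in> S"
    unfolding m_def using assms(1-3) closed_segment_subset midpoint_in_closed_segment by blast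
  have mx: "norm (m - x) = d / 2" and my: "norm (m - y) = d / 2"
    using dist_midpoint[of x y] by (auto simp: m_def d_def dist_norm norm_minus_commute)
  have "\<bar>f m - f x - D x \<bullet> (m - x)\<bar> \<le> L * d\<^sup>2 / 8" "\<bar>f m - f y - D y \<bullet> (m - y)\<bar> \<le> L * d\<^sup>2 / 8"
    using rem[OF m assms(2)] rem[OF m assms(3)]
    by (simp_all add: mx my power_divide)
  moreover have "\<bar>(D x - D y) \<bullet> (a - m)\<bar> \<le> L * d * r"
  proof -
    have "\<bar>(D x - D y) \<bullet> (a - m)\<bar> \<le> norm (D x - D y) * norm (a - m)"
      by (rule Cauchy_Schwarz_ineq2)
    also have "\<dots> \<le> L * d * r"
      using lip unfolding d_def r_def by (rule mult_right_mono) simp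
    finally show ?thesis .
  qed
  moreover have "(f x + D x \<bullet> (a - x)) - (f y + D y \<bullet> (a - y))
      = (f m - f y - D y \<bullet> (m - y)) - (f m - f x - D x \<bullet> (m - x)) + (D x - D y) \<bullet> (a - m)"
    by (simp add: inner_diff_left inner_diff_right)
  ultimately have "\<bar>(f x + D x \<bullet> (a - x)) - (f y + D y \<bullet> (a - y))\<bar> \<le> L * d\<^sup>2 / 4 + L * d * r"
    by linarith
  also have "\<dots> = L * (d\<^sup>2 / 4 + d * r)"
    by (simp add: algebra_simps)
  also have "\<dots> \<le> L * (d\<^sup>2 / 2 + 2 * r\<^sup>2)"
  proof (rule mult_left_mono[OF _ L])
    have "d\<^sup>2 / 2 + 2 * r\<^sup>2 - (d\<^sup>2 / 4 + d * r) = (d / 2 - r)\<^sup>2 + r\<^sup>2"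
      by (simp add: power2_eq_square algebra_simps)
    moreover have "0 \<le> (d / 2 - r)\<^sup>2 + r\<^sup>2"
      by simp
    ultimately show "d\<^sup>2 / 4 + d * r \<le> d\<^sup>2 / 2 + 2 * r\<^sup>2"
      by linarith
  qed
  also have "d\<^sup>2 / 2 + 2 * r\<^sup>2 = (norm (x - a))\<^sup>2 + (norm (y - a))\<^sup>2"
    unfolding d_def r_def m_def midpoint_def power2_norm_eq_inner
    by (simp add: algebra_simps inner_commute) (simp add: field_simps)
  finally show ?thesis .
qed

text \<open>
  A finite \<open>\<Gamma>\<^sup>1\<close> supplies a real constant for all pairs at once. At \<open>a = x\<close> the denominator of the
  quotient is \<open>\<parallel>y - x\<parallel>\<^sup>2\<close>, and \<open>F x x = f x\<close>.
\<close>

lemma finite_Gamma1_on_imp_quadratic_remainder: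
  assumes "one_field_on \<Omega> F f D" "Gamma1_on F \<Omega> < \<infinity>"
  obtains C where
    "\<And>x y. x \<in> \<Omega> \<Longrightarrow> y \<in> \<Omega> \<Longrightarrow> \<bar>f x - f y - D y \<bullet> (x - y)\<bar> \<le> C * (norm (x - y))\<^sup>2"
proof
  fix x y
  assume xy: "x \<in> \<Omega>" "y \<in> \<Omega>"
  show "\<bar>f x - f y - D y \<bullet> (x - y)\<bar> \<le> enn2real (Gamma1_on F \<Omega>) * (norm (x - y))\<^sup>2"
  proof (cases "x = y")
    case False
    let ?q = "\<bar>F x x - F y x\<bar> / ((norm (x - x))\<^sup>2 + (norm (y - x))\<^sup>2)"
    have "ennreal ?q \<le> (SUP a. ennreal (\<bar>F x a - F y a\<bar> / ((norm (x - a))\<^sup>2 + (norm (y - a))\<^sup>2)))"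
      by (rule SUP_upper) simp
    also have "\<dots> \<le> Gamma1 F x y"
      unfolding Gamma1_def mult_2 by simp
    also have "\<dots> \<le> Gamma1_on F \<Omega>"
      unfolding Gamma1_on_def using xy False by (intro SUP_upper2[of "(x, y)"]) auto
    finally have "?q \<le> enn2real (Gamma1_on F \<Omega>)"
      using enn2real_mono[of "ennreal ?q"] assms(2) by simp
    moreover have "F x x - F y x = f x - f y - D y \<bullet> (x - y)"
      using assms(1) xy by (simp add: one_field_on_def)
    ultimately show ?thesis
      using False by (simp add: divide_le_eq norm_minus_commute)
  qed simp
qed

lemma Lip_on_le_ennreal_imp_lipschitz:
  assumes "Lip_on D \<Omega> \<le> ennreal L" "0 \<le> L" "x \<in> \<Omega>" "y \<in> \<Omega>"
  shows "norm (D x - D y) \<le> L * norm (x - y)"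
proof (cases "x = y")
  case False
  have "ennreal (norm (D x - D y) / norm (x - y)) \<le> Lip_on D \<Omega>"
    unfolding Lip_on_def using assms(3,4) False by (intro SUP_upper2[of "(x, y)"]) auto
  with assms(1) have "ennreal (norm (D x - D y) / norm (x - y)) \<le> ennreal L"
    by (rule order_trans[rotated])
  with assms(2) False show ?thesis
    by (simp add: divide_le_eq)
qed simp

theorem proposition8:
  fixes \<Omega> :: "(real^'n) set"
    and F :: "real^'n \<Rightarrow> real^'n \<Rightarrow> real"
    and f :: "real^'n \<Rightarrow> real"
    and D :: "real^'n \<Rightarrow> real^'n"
  assumes "\<Omega> \<noteq> {}" and "open \<Omega>" and "convex \<Omega>"
    and "F \<in> F1 \<Omega>"
    and "one_field_on \<Omega> F f D"
  shows "Gamma1_on F \<Omega> \<le> 2 * Lip_on D \<Omega>"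
proof (cases "Lip_on D \<Omega>")
  case top
  then show ?thesis
    by (simp add: ennreal_mult_top)
next
  case (real L)
  have lip: "norm (D u - D v) \<le> L * norm (u - v)" if "u \<in> \<Omega>" "v \<in> \<Omega>" for u v
    by (rule Lip_on_le_ennreal_imp_lipschitz[OF _ _ that]) (use real in simp_all)
  have "Gamma1_on F \<Omega> < \<infinity>"
    using assms(4) by (simp add: F1_def)
  then obtain C where
    C: "\<And>x y. x \<in> \<Omega> \<Longrightarrow> y \<in> \<Omega> \<Longrightarrow> \<bar>f x - f y - D y \<bullet> (x - y)\<bar> \<le> C * (norm (x - y))\<^sup>2"
    using finite_Gamma1_on_imp_quadratic_remainder[OF assms(5)] by blast
  have deriv: "(f has_derivative (\<lambda>h. D z \<bullet> h)) (at z)" if "z \<in> \<Omega>" for z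
    by (rule has_derivative_if_quadratic_remainder[OF assms(2) that C[OF _ that]])
  have rem: "\<bar>f u - f v - D v \<bullet> (u - v)\<bar> \<le> L / 2 * (norm (u - v))\<^sup>2"
    if "u \<in> \<Omega>" "v \<in> \<Omega>" for u v
    by (rule first_order_remainder_if_lipschitz_gradient[OF assms(3) that deriv lip])
  have "Gamma1 F x y \<le> 2 * ennreal L" if xy: "x \<in> \<Omega>" "y \<in> \<Omega>" "x \<noteq> y" for x y
    unfolding Gamma1_def
  proof (intro mult_left_mono SUP_least)
    fix a
    have "0 < (norm (x - a))\<^sup>2 + (norm (y - a))\<^sup>2"
      using xy(3) by (auto simp: sum_power2_gt_zero_iff)
    moreover have "\<bar>F x a - F y a\<bar> \<le> L * ((norm (x - a))\<^sup>2 + (norm (y - a))\<^sup>2)"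
      using first_order_expansions_diff_le[OF assms(3) xy(1,2) \<open>0 \<le> L\<close> rem lip[OF xy(1,2)], of a]
        assms(5) xy(1,2) by (simp add: one_field_on_def)
    ultimately show
      "ennreal (\<bar>F x a - F y a\<bar> / ((norm (x - a))\<^sup>2 + (norm (y - a))\<^sup>2)) \<le> ennreal L"
      by (intro ennreal_leI) (simp add: divide_le_eq)
  qed simp
  then show ?thesis
    unfolding Gamma1_on_def using real by (auto intro!: SUP_least)
qed

end
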